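(* Let $X$ be a separable metric space. The following statements are equivalent: (1) $X$ is coarsely embeddable into $\ell_2$; (2) $X$ is coarsely embeddable into $L_p(0,1)$ for some $p$ with $1\le p<2$; (2') $X$ is coarsely embeddable into $L_p(0,1)$ for all $p$ with $1\le p<2$.
   Context: A metric space $(X,d_X)$ is coarsely embeddable into a metric space $(Y,d_Y)$ if there is a coarse embedding $f\colon X\to Y$, i.e. a (not necessarily continuous) map for which there exist non-decreasing functions $\rho_1,\rho_2\colon[0,\infty)\to[0,\infty)$ such that $\rho_1(d_X(x,y))\le d_Y(f(x),f(y))\le\rho_2(d_X(x,y))$ for all $x,y\in X$ and $\lim_{t\to\infty}\rho_1(t)=+\infty$. Hilbert spaces are real. $L_p(0,1)$ is the $L_p$-space of Lebesgue measure on $(0,1)$ with its norm metric. *)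

theory Defs
  imports "HOL-Analysis.Analysis"
begin

section \<open>Coarse embeddings\<close>

definition coarse_embedding ::
  "'a set \<Rightarrow> ('a \<Rightarrow> 'a \<Rightarrow> real) \<Rightarrow> 'b set \<Rightarrow> ('b \<Rightarrow> 'b \<Rightarrow> real) \<Rightarrow> ('a \<Rightarrow> 'b) \<Rightarrow> bool"
  where "coarse_embedding X dX Y dY f \<longleftrightarrow>
    f \<in> X \<rightarrow> Y \<and>
    (\<exists>\<rho>\<^sub>1 \<rho>\<^sub>2 :: real \<Rightarrow> real.
      \<rho>\<^sub>1 \<in> {0..} \<rightarrow> {0..} \<and> \<rho>\<^sub>2 \<in> {0..} \<rightarrow> {0..} \<and>
      mono_on {0..} \<rho>\<^sub>1 \<and> mono_on {0..} \<rho>\<^sub>2 \<and>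
      (\<forall>x\<in>X. \<forall>y\<in>X. \<rho>\<^sub>1 (dX x y) \<le> dY (f x) (f y) \<and> dY (f x) (f y) \<le> \<rho>\<^sub>2 (dX x y)) \<and>
      filterlim \<rho>\<^sub>1 at_top at_top)"

definition coarsely_embeddable ::
  "'a set \<Rightarrow> ('a \<Rightarrow> 'a \<Rightarrow> real) \<Rightarrow> 'b set \<Rightarrow> ('b \<Rightarrow> 'b \<Rightarrow> real) \<Rightarrow> bool"
  where "coarsely_embeddable X dX Y dY \<longleftrightarrow> (\<exists>f. coarse_embedding X dX Y dY f)"


section \<open>The real Hilbert space \<open>\<ell>\<^sub>2\<close>\<close>

definition ell2 :: "(nat \<Rightarrow> real) set"
  where "ell2 = {x. (\<lambda>n. (x n)\<^sup>2) summable_on UNIV}"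

definition ell2_dist :: "(nat \<Rightarrow> real) \<Rightarrow> (nat \<Rightarrow> real) \<Rightarrow> real"
  where "ell2_dist x y = sqrt (\<Sum>\<^sub>\<infinity>n. (x n - y n)\<^sup>2)"

lemma ell2_add:
  assumes "x \<in> ell2" "y \<in> ell2"
  shows "(\<lambda>n. x n + y n) \<in> ell2"
    and "sqrt (\<Sum>\<^sub>\<infinity>n. (x n + y n)\<^sup>2) \<le> sqrt (\<Sum>\<^sub>\<infinity>n. (x n)\<^sup>2) + sqrt (\<Sum>\<^sub>\<infinity>n. (y n)\<^sup>2)"
proof -
  let ?a = "sqrt (\<Sum>\<^sub>\<infinity>n. (x n)\<^sup>2)" and ?b = "sqrt (\<Sum>\<^sub>\<infinity>n. (y n)\<^sup>2)"
  have le: "L2_set z F \<le> sqrt (\<Sum>\<^sub>\<infinity>n. (z n)\<^sup>2)" if "z \<in> ell2" "finite F" for z F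
    using that unfolding L2_set_def ell2_def
    by (auto intro!: finite_sum_le_infsum)
  have nn: "0 \<le> ?a" "0 \<le> ?b" by (simp_all add: infsum_nonneg)
  have bound: "(\<Sum>n\<in>F. (x n + y n)\<^sup>2) \<le> (?a + ?b)\<^sup>2" if "finite F" for F
  proof -
    have "L2_set (\<lambda>n. x n + y n) F \<le> ?a + ?b"
      using L2_set_triangle_ineq[of x y F] le[OF assms(1) that] le[OF assms(2) that] by linarith
    then show ?thesis
      unfolding L2_set_def using real_le_rsqrt sqrt_le_D by blast
  qed
  have s: "(\<lambda>n. (x n + y n)\<^sup>2) summable_on UNIV"
    using bound by (intro nonneg_bounded_partial_sums_imp_summable_on[where C = "(?a + ?b)\<^sup>2"]
        eventually_finite_subsets_at_top_weakI) auto
  then show "(\<lambda>n. x n + y n) \<in> ell2" by (simp add: ell2_def)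
  have "(\<Sum>\<^sub>\<infinity>n. (x n + y n)\<^sup>2) \<le> (?a + ?b)\<^sup>2"
    using s bound by (intro infsum_le_finite_sums) auto
  then show "sqrt (\<Sum>\<^sub>\<infinity>n. (x n + y n)\<^sup>2) \<le> ?a + ?b"
    using nn by (meson add_nonneg_nonneg real_le_lsqrt)
qed

lemma Metric_space_ell2: "Metric_space ell2 ell2_dist"
proof
  have diff: "(\<lambda>n. x n - y n) \<in> ell2" if "x \<in> ell2" "y \<in> ell2" for x y
    using ell2_add(1)[of x "\<lambda>n. - y n"] that by (simp add: ell2_def)
  show "0 \<le> ell2_dist x y" for x y
    by (simp add: ell2_dist_def infsum_nonneg)
  show "ell2_dist x y = ell2_dist y x" for x y
    by (simp add: ell2_dist_def power2_commute)
  show "ell2_dist x y = 0 \<longleftrightarrow> x = y" if "x \<in> ell2" "y \<in> ell2" for x y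
  proof
    assume "ell2_dist x y = 0"
    then have "(\<Sum>\<^sub>\<infinity>n. (x n - y n)\<^sup>2) \<le> 0" by (simp add: ell2_dist_def)
    then have "(x n - y n)\<^sup>2 = 0" for n
      using diff[OF that] nonneg_infsum_le_0D[of "\<lambda>n. (x n - y n)\<^sup>2" UNIV n]
      by (simp add: ell2_def)
    then show "x = y" by auto
  qed (simp add: ell2_dist_def)
  show "ell2_dist x z \<le> ell2_dist x y + ell2_dist y z"
    if "x \<in> ell2" "y \<in> ell2" "z \<in> ell2" for x y z
    using ell2_add(2)[OF diff[OF that(1,2)] diff[OF that(2,3)]] by (simp add: ell2_dist_def)
qed


section \<open>The spaces \<open>L\<^sub>p\<close>\<close>

definition Lp_functions :: "'a measure \<Rightarrow> real \<Rightarrow> ('a \<Rightarrow> real) set"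
  where "Lp_functions M p = {f \<in> borel_measurable M. integrable M (\<lambda>x. \<bar>f x\<bar> powr p)}"

definition Lp_norm :: "'a measure \<Rightarrow> real \<Rightarrow> ('a \<Rightarrow> real) \<Rightarrow> real"
  where "Lp_norm M p f = (\<integral>x. \<bar>f x\<bar> powr p \<partial>M) powr (1 / p)"

definition Lp_rel :: "'a measure \<Rightarrow> real \<Rightarrow> (('a \<Rightarrow> real) \<times> ('a \<Rightarrow> real)) set"
  where "Lp_rel M p =
    {(f, g). f \<in> Lp_functions M p \<and> g \<in> Lp_functions M p \<and> (AE x in M. f x = g x)}"

definition Lp_space :: "'a measure \<Rightarrow> real \<Rightarrow> ('a \<Rightarrow> real) set set"
  where "Lp_space M p = Lp_functions M p // Lp_rel M p"

text \<open>Independence of the representatives is shown in \<open>Lp_dist_class\<close> below.\<close>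

definition Lp_dist :: "'a measure \<Rightarrow> real \<Rightarrow> ('a \<Rightarrow> real) set \<Rightarrow> ('a \<Rightarrow> real) set \<Rightarrow> real"
  where "Lp_dist M p F G = Lp_norm M p (\<lambda>x. (SOME f. f \<in> F) x - (SOME g. g \<in> G) x)"

text \<open>Functions on \<open>(0,1)\<close> are represented by functions on \<open>\<real>\<close>; their values off \<open>(0,1)\<close> are
  invisible to the measure, hence identified by \<^const>\<open>Lp_rel\<close>.\<close>

abbreviation Lp01 :: "real \<Rightarrow> (real \<Rightarrow> real) set set"
  where "Lp01 p \<equiv> Lp_space (lebesgue_on {0<..<1}) p"

abbreviation Lp01_dist :: "real \<Rightarrow> (real \<Rightarrow> real) set \<Rightarrow> (real \<Rightarrow> real) set \<Rightarrow> real"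
  where "Lp01_dist p \<equiv> Lp_dist (lebesgue_on {0<..<1}) p"

lemma equiv_Lp_rel: "equiv (Lp_functions M p) (Lp_rel M p)"
proof (rule equivI)
  show "Lp_rel M p \<subseteq> Lp_functions M p \<times> Lp_functions M p"
    by (auto simp: Lp_rel_def)
  show "refl_on (Lp_functions M p) (Lp_rel M p)"
    by (auto simp: refl_on_def Lp_rel_def)
  show "sym (Lp_rel M p)"
    by (auto simp: sym_def Lp_rel_def elim: eventually_mono)
  show "trans (Lp_rel M p)"
    by (auto simp: trans_def Lp_rel_def elim: eventually_elim2)
qed

lemma Lp_norm_nonneg: "0 \<le> Lp_norm M p f"
  by (simp add: Lp_norm_def)

lemma Lp_norm_powr:
  assumes "0 < p"
  shows "Lp_norm M p f powr p = (\<integral>x. \<bar>f x\<bar> powr p \<partial>M)"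
  using assms by (simp add: Lp_norm_def powr_powr)

lemma Lp_norm_cong_AE:
  assumes "f \<in> borel_measurable M" "g \<in> borel_measurable M" "AE x in M. f x = g x"
  shows "Lp_norm M p f = Lp_norm M p g"
proof -
  have "(\<integral>x. \<bar>f x\<bar> powr p \<partial>M) = (\<integral>x. \<bar>g x\<bar> powr p \<partial>M)"
    using assms by (intro integral_cong_AE) (auto elim: eventually_mono)
  then show ?thesis by (simp add: Lp_norm_def)
qed

lemma Lp_norm_eq_0_iff:
  assumes "f \<in> Lp_functions M p"
  shows "Lp_norm M p f = 0 \<longleftrightarrow> (AE x in M. f x = 0)"
proof -
  have "Lp_norm M p f = 0 \<longleftrightarrow> (\<integral>x. \<bar>f x\<bar> powr p \<partial>M) = 0"
    by (simp add: Lp_norm_def)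
  also have "\<dots> \<longleftrightarrow> (AE x in M. \<bar>f x\<bar> powr p = 0)"
    using assms by (intro integral_nonneg_eq_0_iff_AE) (auto simp: Lp_functions_def)
  finally show ?thesis by simp
qed

lemma powr_convex_combination:
  fixes p s t x y :: real
  assumes "1 \<le> p" "0 \<le> x" "0 \<le> y" "0 < s" "0 < t" "s + t = 1"
  shows "(s * x + t * y) powr p \<le> s * x powr p + t * y powr p"
proof -
  have le: "(r * z) powr p \<le> r * z powr p" if "0 < r" "r \<le> 1" "0 \<le> z" for r z :: real
  proof -
    have "r powr p \<le> r"
      using powr_mono'[of 1 p r] that assms(1) by simp
    then show ?thesis
      using that by (simp add: powr_mult mult_right_mono)
  qed
  have s: "s = 1 - t" using assms(6) by simp
  consider "x = 0" | "y = 0" | "x > 0" "y > 0" using assms by linarith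
  then show ?thesis
  proof cases
    case 1
    then show ?thesis using le[of t y] assms by simp
  next
    case 2
    then show ?thesis using le[of s x] assms by simp
  next
    case 3
    then show ?thesis
      using convex_onD[OF powr_convex[OF assms(1)], of t x y] assms(4,5) s by simp
  qed
qed

lemma Lp_functions_add:
  assumes "1 \<le> p" "f \<in> Lp_functions M p" "g \<in> Lp_functions M p"
  shows "(\<lambda>x. f x + g x) \<in> Lp_functions M p"
proof -
  have [measurable]: "f \<in> borel_measurable M" "g \<in> borel_measurable M"
    using assms by (auto simp: Lp_functions_def)
  have *: "\<bar>a + b\<bar> powr p \<le> 2 powr p * (\<bar>a\<bar> powr p + \<bar>b\<bar> powr p)" for a b :: real
  proof -
    have "\<bar>a + b\<bar> powr p \<le> (2 * max \<bar>a\<bar> \<bar>b\<bar>) powr p"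
      using assms(1) by (intro powr_mono2) auto
    also have "\<dots> = 2 powr p * max \<bar>a\<bar> \<bar>b\<bar> powr p"
      by (simp add: powr_mult)
    also have "\<dots> \<le> 2 powr p * (\<bar>a\<bar> powr p + \<bar>b\<bar> powr p)"
      by (intro mult_left_mono) (auto simp: max_def)
    finally show ?thesis .
  qed
  have "integrable M (\<lambda>x. \<bar>f x + g x\<bar> powr p)"
  proof (rule Bochner_Integration.integrable_bound)
    show "integrable M (\<lambda>x. 2 powr p * (\<bar>f x\<bar> powr p + \<bar>g x\<bar> powr p))"
      using assms by (auto simp: Lp_functions_def)
    show "AE x in M. norm (\<bar>f x + g x\<bar> powr p) \<le> norm (2 powr p * (\<bar>f x\<bar> powr p + \<bar>g x\<bar> powr p))"
      using * by (auto simp: abs_mult)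
  qed measurable
  then show ?thesis by (simp add: Lp_functions_def)
qed

lemma Lp_functions_diff:
  assumes "1 \<le> p" "f \<in> Lp_functions M p" "g \<in> Lp_functions M p"
  shows "(\<lambda>x. f x - g x) \<in> Lp_functions M p"
  using Lp_functions_add[OF assms(1,2), of "\<lambda>x. - g x"] assms(3)
  by (simp add: Lp_functions_def)

lemma Lp_norm_triangle:
  assumes p: "1 \<le> p" and f: "f \<in> Lp_functions M p" and g: "g \<in> Lp_functions M p"
  shows "Lp_norm M p (\<lambda>x. f x + g x) \<le> Lp_norm M p f + Lp_norm M p g"
proof -
  let ?a = "Lp_norm M p f" and ?b = "Lp_norm M p g"
  have [measurable]: "f \<in> borel_measurable M" "g \<in> borel_measurable M"
    using f g by (auto simp: Lp_functions_def)
  consider "?a = 0" | "?b = 0" | "?a > 0" "?b > 0"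
    using Lp_norm_nonneg[of M p f] Lp_norm_nonneg[of M p g] by linarith
  then show ?thesis
  proof cases
    case 1
    then have "AE x in M. f x = 0" using Lp_norm_eq_0_iff[OF f] by simp
    then have "Lp_norm M p (\<lambda>x. f x + g x) = ?b"
      by (intro Lp_norm_cong_AE) (auto elim: eventually_mono)
    then show ?thesis using 1 by simp
  next
    case 2
    then have "AE x in M. g x = 0" using Lp_norm_eq_0_iff[OF g] by simp
    then have "Lp_norm M p (\<lambda>x. f x + g x) = ?a"
      by (intro Lp_norm_cong_AE) (auto elim: eventually_mono)
    then show ?thesis using 2 by simp
  next
    case 3
    let ?c = "?a + ?b"
    let ?h = "\<lambda>x. ?c powr p * (?a / ?c * (\<bar>f x\<bar> powr p / ?a powr p) + ?b / ?c * (\<bar>g x\<bar> powr p / ?b powr p))"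
    have fi: "integrable M (\<lambda>x. \<bar>f x\<bar> powr p)" and gi: "integrable M (\<lambda>x. \<bar>g x\<bar> powr p)"
      using f g by (auto simp: Lp_functions_def)
    have pt: "\<bar>f x + g x\<bar> powr p \<le> ?h x" for x
    proof -
      have st: "?a / ?c + ?b / ?c = 1" using 3 by (simp flip: add_divide_distrib)
      have "\<bar>f x + g x\<bar> powr p \<le> (\<bar>f x\<bar> + \<bar>g x\<bar>) powr p"
        using p by (intro powr_mono2) auto
      also have "\<bar>f x\<bar> + \<bar>g x\<bar> = ?c * (?a / ?c * (\<bar>f x\<bar> / ?a) + ?b / ?c * (\<bar>g x\<bar> / ?b))"
        using 3 by (simp add: distrib_left)
      also have "\<dots> powr p = ?c powr p * (?a / ?c * (\<bar>f x\<bar> / ?a) + ?b / ?c * (\<bar>g x\<bar> / ?b)) powr p"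
        by (rule powr_mult)
      also have "\<dots> \<le> ?c powr p *
          (?a / ?c * (\<bar>f x\<bar> / ?a) powr p + ?b / ?c * (\<bar>g x\<bar> / ?b) powr p)"
        using 3 p st by (intro mult_left_mono powr_convex_combination) auto
      finally show ?thesis using 3 by (simp add: powr_divide)
    qed
    have "(\<integral>x. \<bar>f x + g x\<bar> powr p \<partial>M) \<le> (\<integral>x. ?h x \<partial>M)"
      using Lp_functions_add[OF p f g] fi gi pt
      by (intro integral_mono) (auto simp: Lp_functions_def)
    also have "\<dots> = ?c powr p * (?a / ?c * (?a powr p / ?a powr p) + ?b / ?c * (?b powr p / ?b powr p))"
      using fi gi p by (simp add: Lp_norm_powr)
    also have "\<dots> = ?c powr p"
      using 3 by (simp flip: add_divide_distrib)
    finally have "Lp_norm M p (\<lambda>x. f x + g x) \<le> (?c powr p) powr (1 / p)"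
      unfolding Lp_norm_def[of M p "\<lambda>x. f x + g x"] using p by (intro powr_mono2) auto
    then show ?thesis using 3 p by (simp add: powr_powr)
  qed
qed

lemma Lp_dist_class:
  assumes "f \<in> Lp_functions M p" "g \<in> Lp_functions M p"
  shows "Lp_dist M p (Lp_rel M p `` {f}) (Lp_rel M p `` {g}) = Lp_norm M p (\<lambda>x. f x - g x)"
proof -
  have rep: "(SOME k. k \<in> Lp_rel M p `` {h}) \<in> Lp_rel M p `` {h}" if "h \<in> Lp_functions M p" for h
    using equiv_class_self[OF equiv_Lp_rel that] by (rule someI[where P = "\<lambda>k. k \<in> Lp_rel M p `` {h}"])
  have meas: "h \<in> borel_measurable M" if "h \<in> Lp_functions M p" for h
    using that by (simp add: Lp_functions_def)
  let ?f = "SOME k. k \<in> Lp_rel M p `` {f}" and ?g = "SOME k. k \<in> Lp_rel M p `` {g}"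
  have "(f, ?f) \<in> Lp_rel M p" "(g, ?g) \<in> Lp_rel M p"
    using rep[OF assms(1)] rep[OF assms(2)] by (simp_all only: Image_singleton_iff)
  moreover have rel: "k \<in> Lp_functions M p \<and> (AE x in M. h x = k x)" if "(h, k) \<in> Lp_rel M p" for h k
    using that by (simp add: Lp_rel_def)
  ultimately have *: "?f \<in> Lp_functions M p" "?g \<in> Lp_functions M p"
      "AE x in M. f x = ?f x" "AE x in M. g x = ?g x"
    using rel[of f ?f] rel[of g ?g] by simp_all
  have "AE x in M. ?f x - ?g x = f x - g x"
    using *(3,4) by eventually_elim simp
  then show ?thesis
    unfolding Lp_dist_def using meas[OF *(1)] meas[OF *(2)] assms meas
    by (intro Lp_norm_cong_AE borel_measurable_diff) auto
qed

lemma Metric_space_Lp: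
  assumes p: "1 \<le> p"
  shows "Metric_space (Lp_space M p) (Lp_dist M p)"
proof
  have rep: "\<exists>f. f \<in> Lp_functions M p \<and> F = Lp_rel M p `` {f}" if "F \<in> Lp_space M p" for F
    using that by (auto simp: Lp_space_def quotient_def)
  show "0 \<le> Lp_dist M p F G" for F G
    by (simp add: Lp_dist_def Lp_norm_nonneg)
  show "Lp_dist M p F G = Lp_dist M p G F" for F G
    by (simp add: Lp_dist_def Lp_norm_def abs_minus_commute)
  show "Lp_dist M p F G = 0 \<longleftrightarrow> F = G" if FG: "F \<in> Lp_space M p" "G \<in> Lp_space M p" for F G
  proof -
    obtain f where f: "f \<in> Lp_functions M p" "F = Lp_rel M p `` {f}"
      using rep[OF FG(1)] by (elim exE conjE)
    obtain g where g: "g \<in> Lp_functions M p" "G = Lp_rel M p `` {g}"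
      using rep[OF FG(2)] by (elim exE conjE)
    have "Lp_dist M p F G = 0 \<longleftrightarrow> (AE x in M. f x - g x = 0)"
      using f g Lp_norm_eq_0_iff[OF Lp_functions_diff[OF p f(1) g(1)]] by (simp add: Lp_dist_class)
    also have "\<dots> \<longleftrightarrow> (f, g) \<in> Lp_rel M p"
      using f g by (simp add: Lp_rel_def)
    also have "\<dots> \<longleftrightarrow> F = G"
      using eq_equiv_class_iff[OF equiv_Lp_rel f(1) g(1)] f(2) g(2) by simp
    finally show ?thesis .
  qed
  show "Lp_dist M p F H \<le> Lp_dist M p F G + Lp_dist M p G H"
    if FGH: "F \<in> Lp_space M p" "G \<in> Lp_space M p" "H \<in> Lp_space M p" for F G H
  proof -
    obtain f where f: "f \<in> Lp_functions M p" "F = Lp_rel M p `` {f}"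
      using rep[OF FGH(1)] by (elim exE conjE)
    obtain g where g: "g \<in> Lp_functions M p" "G = Lp_rel M p `` {g}"
      using rep[OF FGH(2)] by (elim exE conjE)
    obtain h where h: "h \<in> Lp_functions M p" "H = Lp_rel M p `` {h}"
      using rep[OF FGH(3)] by (elim exE conjE)
    show ?thesis
      using f g h Lp_norm_triangle[OF p Lp_functions_diff[OF p f(1) g(1)] Lp_functions_diff[OF p g(1) h(1)]]
      by (simp add: Lp_dist_class)
  qed
qed

end

theory Submission
  imports Defs "HOL-Real_Asymp.Real_Asymp"
begin

text \<open>
Coarse embeddings tolerate bounded perturbations of points and coarse changes of the metric, and this
reduces both directions to statements about countable or finitely supported data.

From \<open>\<ell>\<^sub>2\<close> to \<open>L\<^sub>p(0,1)\<close>: every point of \<open>\<ell>\<^sub>2\<close> is within distance \<open>1\<close> of a finitely supported sequence. Sending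
such a sequence to the corresponding finite sum of Rademacher functions is bi-Lipschitz for the \<open>L\<^sub>p\<close>
norm by Khinchin's inequality (\<open>khinchin\<close>), which follows from the second and fourth moments of
Rademacher sums.

From \<open>L\<^sub>p\<close> to \<open>\<ell>\<^sub>2\<close> for \<open>p < 2\<close>: the function \<open>|s| powr p\<close> is a positive integral of functions
\<open>1 - cos (s * u)\<close>, so \<open>|x| powr p + |y| powr p - |x - y| powr p\<close> is a positive semidefinite kernel on the reals
(\<open>psd_kernel_powr\<close>). Integrating it shows that \<open>\<parallel>f\<parallel>\<^sup>p + \<parallel>g\<parallel>\<^sup>p - \<parallel>f - g\<parallel>\<^sup>p\<close> is positive semidefinite on \<open>L\<^sub>p\<close>, which
means that the metric \<open>\<parallel>f - g\<parallel> powr (p / 2)\<close> is Euclidean. By separability only a countable subset of \<open>X\<close>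
matters, and a positive semidefinite kernel on a countable set is realised in \<open>\<ell>\<^sub>2\<close> by a Cholesky
factorisation (\<open>psd_kernel_embeds_ell2\<close>). Raising distances to the power \<open>p / 2\<close> does not affect coarse
embeddability.
\<close>

section \<open>Perturbing coarse embeddings\<close>

text \<open>Coarse embeddings only see large-scale distances, so the target may be changed as long as old and
new distances control each other; the new moduli are \<open>\<alpha> \<circ> \<rho>\<^sub>1\<close> and \<open>\<beta> \<circ> \<rho>\<^sub>2\<close>.\<close>

lemma coarse_embedding_control_target:
  assumes X: "Metric_space X d" and f: "coarse_embedding X d Y dY f" and g: "g \<in> X \<rightarrow> Z"
    and \<alpha>: "\<alpha> \<in> {0..} \<rightarrow> {0..}" "mono_on {0..} \<alpha>" "filterlim \<alpha> at_top at_top"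
    and \<beta>: "\<beta> \<in> {0..} \<rightarrow> {0..}" "mono_on {0..} \<beta>"
    and lower: "\<And>x y. x \<in> X \<Longrightarrow> y \<in> X \<Longrightarrow> \<alpha> (dY (f x) (f y)) \<le> dZ (g x) (g y)"
    and upper: "\<And>x y. x \<in> X \<Longrightarrow> y \<in> X \<Longrightarrow> dZ (g x) (g y) \<le> \<beta> (dY (f x) (f y))"
  shows "coarse_embedding X d Z dZ g"
proof -
  interpret Metric_space X d by fact
  obtain \<rho>\<^sub>1 \<rho>\<^sub>2 where \<rho>: "\<rho>\<^sub>1 \<in> {0..} \<rightarrow> {0..}" "\<rho>\<^sub>2 \<in> {0..} \<rightarrow> {0..}"
      "mono_on {0..} \<rho>\<^sub>1" "mono_on {0..} \<rho>\<^sub>2" "filterlim \<rho>\<^sub>1 at_top at_top"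
    and le: "\<And>x y. x \<in> X \<Longrightarrow> y \<in> X \<Longrightarrow> \<rho>\<^sub>1 (d x y) \<le> dY (f x) (f y)"
      "\<And>x y. x \<in> X \<Longrightarrow> y \<in> X \<Longrightarrow> dY (f x) (f y) \<le> \<rho>\<^sub>2 (d x y)"
    using f unfolding coarse_embedding_def by blast
  have nn: "0 \<le> \<rho>\<^sub>1 t" "0 \<le> \<rho>\<^sub>2 t" if "0 \<le> t" for t
    using \<rho>(1,2) that by auto
  show ?thesis
    unfolding coarse_embedding_def
  proof (intro conjI exI ballI)
    show "(\<lambda>t. \<alpha> (\<rho>\<^sub>1 t)) \<in> {0..} \<rightarrow> {0..}" "(\<lambda>t. \<beta> (\<rho>\<^sub>2 t)) \<in> {0..} \<rightarrow> {0..}"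
      using \<rho>(1,2) \<alpha>(1) \<beta>(1) by auto
    show "mono_on {0..} (\<lambda>t. \<alpha> (\<rho>\<^sub>1 t))" "mono_on {0..} (\<lambda>t. \<beta> (\<rho>\<^sub>2 t))"
      using \<rho>(3,4) \<alpha>(2) \<beta>(2) nn by (auto simp: monotone_on_def)
    show "filterlim (\<lambda>t. \<alpha> (\<rho>\<^sub>1 t)) at_top at_top"
      using filterlim_compose[OF \<alpha>(3) \<rho>(5)] .
    fix x y assume xy: "x \<in> X" "y \<in> X"
    have 0: "0 \<le> dY (f x) (f y)"
      using nn(1)[of "d x y"] le(1)[OF xy] by simp
    have "\<alpha> (\<rho>\<^sub>1 (d x y)) \<le> \<alpha> (dY (f x) (f y))"
      using le(1)[OF xy] nn(1)[of "d x y"] 0 by (intro mono_onD[OF \<alpha>(2)]) auto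
    with lower[OF xy] show "\<alpha> (\<rho>\<^sub>1 (d x y)) \<le> dZ (g x) (g y)" by simp
    have "\<beta> (dY (f x) (f y)) \<le> \<beta> (\<rho>\<^sub>2 (d x y))"
      using le(2)[OF xy] nn(2)[of "d x y"] 0 by (intro mono_onD[OF \<beta>(2)]) auto
    with upper[OF xy] show "dZ (g x) (g y) \<le> \<beta> (\<rho>\<^sub>2 (d x y))" by simp
  qed (use g in auto)
qed

lemma filterlim_truncated_shift: "filterlim (\<lambda>t. max 0 (t - c)) at_top at_top" for c :: real
proof (rule filterlim_at_top_mono)
  show "filterlim (\<lambda>t. t - c) at_top at_top"
    using filterlim_tendsto_add_at_top[OF tendsto_const[of "- c"] filterlim_ident] by simp
qed simp

text \<open>Moving both points by at most \<open>1\<close> changes their distance by at most \<open>2\<close>, which the moduli absorb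
after a shift of their argument. Together with the next lemma this replaces a separable space by
a countable subset, although a coarse embedding need not be continuous.\<close>

lemma coarse_embedding_perturb_source:
  assumes X: "Metric_space X d" and f: "coarse_embedding X d Y dY f"
    and \<pi>: "\<pi> \<in> X \<rightarrow> X" "\<And>x. x \<in> X \<Longrightarrow> d x (\<pi> x) \<le> 1"
  shows "coarse_embedding X d Y dY (\<lambda>x. f (\<pi> x))"
proof -
  interpret Metric_space X d by fact
  obtain \<rho>\<^sub>1 \<rho>\<^sub>2 where \<rho>: "\<rho>\<^sub>1 \<in> {0..} \<rightarrow> {0..}" "\<rho>\<^sub>2 \<in> {0..} \<rightarrow> {0..}"
      "mono_on {0..} \<rho>\<^sub>1" "mono_on {0..} \<rho>\<^sub>2" "filterlim \<rho>\<^sub>1 at_top at_top"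
    and le: "\<And>x y. x \<in> X \<Longrightarrow> y \<in> X \<Longrightarrow> \<rho>\<^sub>1 (d x y) \<le> dY (f x) (f y)"
      "\<And>x y. x \<in> X \<Longrightarrow> y \<in> X \<Longrightarrow> dY (f x) (f y) \<le> \<rho>\<^sub>2 (d x y)" and fY: "f \<in> X \<rightarrow> Y"
    using f unfolding coarse_embedding_def by blast
  show ?thesis
    unfolding coarse_embedding_def
  proof (intro conjI exI ballI)
    show "(\<lambda>t. \<rho>\<^sub>1 (max 0 (t - 2))) \<in> {0..} \<rightarrow> {0..}" "(\<lambda>t. \<rho>\<^sub>2 (t + 2)) \<in> {0..} \<rightarrow> {0..}"
      using \<rho>(1,2) by auto
    show "mono_on {0..} (\<lambda>t. \<rho>\<^sub>1 (max 0 (t - 2)))" "mono_on {0..} (\<lambda>t. \<rho>\<^sub>2 (t + 2))"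
      using \<rho>(3,4) by (auto simp: monotone_on_def)
    show "filterlim (\<lambda>t. \<rho>\<^sub>1 (max 0 (t - 2))) at_top at_top"
      using filterlim_compose[OF \<rho>(5) filterlim_truncated_shift] .
    show "(\<lambda>x. f (\<pi> x)) \<in> X \<rightarrow> Y" using fY \<pi>(1) by auto
    fix x y assume xy: "x \<in> X" "y \<in> X"
    then have \<pi>X: "\<pi> x \<in> X" "\<pi> y \<in> X" using \<pi>(1) by auto
    have "d x y \<le> d x (\<pi> x) + d (\<pi> x) (\<pi> y) + d (\<pi> y) y"
      using triangle[of x "\<pi> x" y] triangle[of "\<pi> x" "\<pi> y" y] xy \<pi>X by simp
    then have "max 0 (d x y - 2) \<le> d (\<pi> x) (\<pi> y)"
      using \<pi>(2)[OF xy(1)] \<pi>(2)[OF xy(2)] by (simp add: commute)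
    then have "\<rho>\<^sub>1 (max 0 (d x y - 2)) \<le> \<rho>\<^sub>1 (d (\<pi> x) (\<pi> y))"
      by (intro mono_onD[OF \<rho>(3)]) auto
    with le(1)[OF \<pi>X] show "\<rho>\<^sub>1 (max 0 (d x y - 2)) \<le> dY (f (\<pi> x)) (f (\<pi> y))" by simp
    have "d (\<pi> x) (\<pi> y) \<le> d (\<pi> x) x + d x y + d y (\<pi> y)"
      using triangle[of "\<pi> x" x "\<pi> y"] triangle[of x y "\<pi> y"] xy \<pi>X by simp
    then have "d (\<pi> x) (\<pi> y) \<le> d x y + 2"
      using \<pi>(2)[OF xy(1)] \<pi>(2)[OF xy(2)] by (simp add: commute)
    then have "\<rho>\<^sub>2 (d (\<pi> x) (\<pi> y)) \<le> \<rho>\<^sub>2 (d x y + 2)"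
      by (intro mono_onD[OF \<rho>(4)]) auto
    with le(2)[OF \<pi>X] show "dY (f (\<pi> x)) (f (\<pi> y)) \<le> \<rho>\<^sub>2 (d x y + 2)" by simp
  qed
qed

lemma separable_countable_net:
  assumes "Metric_space X d" "separable_space (Metric_space.mtopology X d)"
  obtains C \<pi> where "countable C" "C \<subseteq> X" "\<pi> \<in> X \<rightarrow> C" "\<And>x. x \<in> X \<Longrightarrow> d x (\<pi> x) \<le> 1"
proof -
  interpret Metric_space X d by fact
  obtain C where C: "countable C" "C \<subseteq> X" "mtopology closure_of C = X"
    using assms(2) by (auto simp: separable_space_def)
  have "\<exists>y. y \<in> C \<and> d x y \<le> 1" if "x \<in> X" for x
  proof -
    have "x \<in> mtopology closure_of C" using that C(3) by simp
    then obtain y where "y \<in> C" "y \<in> mball x 1"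
      unfolding metric_closure_of by (auto dest: spec[of _ "1::real"])
    then show ?thesis by (intro exI[of _ y]) auto
  qed
  then obtain \<pi> where "\<And>x. x \<in> X \<Longrightarrow> \<pi> x \<in> C \<and> d x (\<pi> x) \<le> 1" by metis
  then show ?thesis using C that[of C \<pi>] by auto
qed

section \<open>Positive semidefinite kernels and Gram matrices in \<open>\<ell>\<^sub>2\<close>\<close>

definition psd_kernel :: "('i \<Rightarrow> 'i \<Rightarrow> real) \<Rightarrow> bool"
  where "psd_kernel K \<longleftrightarrow> (\<forall>i j. K i j = K j i) \<and>
    (\<forall>A c. finite A \<longrightarrow> 0 \<le> (\<Sum>i\<in>A. \<Sum>j\<in>A. c i * c j * K i j))"

lemma psd_kernelD:
  assumes "psd_kernel K"
  shows "K i j = K j i" "finite A \<Longrightarrow> 0 \<le> (\<Sum>i\<in>A. \<Sum>j\<in>A. c i * c j * K i j)"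
  using assms unfolding psd_kernel_def by blast+

text \<open>The kernel of \<open>L\<^sub>p\<close> is assembled below from kernels of this form by sums, nonnegative multiples and
integrals.\<close>

lemma psd_kernel_rank_one: "psd_kernel (\<lambda>i j. a i * a j)"
proof -
  have "(\<Sum>i\<in>A. \<Sum>j\<in>A. c i * c j * (a i * a j)) = (\<Sum>i\<in>A. c i * a i)\<^sup>2" for A and c :: "'a \<Rightarrow> real"
    by (simp add: power2_eq_square sum_product mult_ac)
  then show ?thesis by (simp add: psd_kernel_def mult.commute)
qed

lemma psd_kernel_add:
  assumes "psd_kernel K" "psd_kernel L"
  shows "psd_kernel (\<lambda>i j. K i j + L i j)"
  using assms unfolding psd_kernel_def by (simp add: distrib_left sum.distrib)

lemma psd_kernel_scale:
  assumes "psd_kernel K" "0 \<le> w"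
  shows "psd_kernel (\<lambda>i j. w * K i j)"
proof -
  have "(\<Sum>i\<in>A. \<Sum>j\<in>A. c i * c j * (w * K i j)) = w * (\<Sum>i\<in>A. \<Sum>j\<in>A. c i * c j * K i j)" for A c
    by (simp add: sum_distrib_left mult_ac)
  then show ?thesis using assms unfolding psd_kernel_def by simp
qed

lemma psd_kernel_integral:
  assumes "\<And>x. psd_kernel (K x)" "\<And>i j. integrable M (\<lambda>x. K x i j)"
  shows "psd_kernel (\<lambda>i j. \<integral>x. K x i j \<partial>M)"
proof -
  have "(\<Sum>i\<in>A. \<Sum>j\<in>A. c i * c j * (\<integral>x. K x i j \<partial>M))
      = (\<integral>x. (\<Sum>i\<in>A. \<Sum>j\<in>A. c i * c j * K x i j) \<partial>M)" for A c
    using assms(2) by simp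
  moreover have "0 \<le> (\<integral>x. (\<Sum>i\<in>A. \<Sum>j\<in>A. c i * c j * K x i j) \<partial>M)" if "finite A" for A c
    using psd_kernelD(2)[OF assms(1) that] by (intro integral_nonneg_AE AE_I2)
  moreover have "K x i j = K x j i" for x i j using psd_kernelD(1)[OF assms(1)] .
  ultimately show ?thesis unfolding psd_kernel_def by (auto intro!: Bochner_Integration.integral_cong)
qed

lemma psd_kernel_diag_nonneg:
  assumes "psd_kernel K"
  shows "0 \<le> K i i"
  using psd_kernelD(2)[OF assms, of "{i}" "\<lambda>_. 1"] by simp

text \<open>If the diagonal entry vanishes, the form is affine along the \<open>m\<close>-th coordinate direction, and an
affine function that is bounded below is constant.\<close>

lemma psd_kernel_zero_row:
  assumes K: "psd_kernel K" and 0: "K m m = 0"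
  shows "K m j = 0"
proof (cases "j = m")
  case False
  have *: "0 \<le> 2 * s * K m j + K j j" for s
    using psd_kernelD(2)[OF K, of "{m, j}" "\<lambda>i. if i = m then s else 1"] False 0
      psd_kernelD(1)[OF K, of j m] by simp
  show ?thesis
  proof (rule ccontr)
    assume ne: "K m j \<noteq> 0"
    \<comment> \<open>this choice of \<open>s\<close> makes the right-hand side of \<open>*\<close> equal to \<open>-1\<close>\<close>
    show False using *[of "- (K j j + 1) / (2 * K m j)"] ne by (simp add: field_simps)
  qed
qed (use 0 in simp)

text \<open>Minimising the quadratic form of \<open>K\<close> over the coefficient of \<open>m\<close> gives the quadratic form of the
Schur complement: for a coefficient vector \<open>c\<close>, the minimum is attained by subtracting
\<open>s = (\<Sum>i. c i * K i m) / K m m\<close> from the \<open>m\<close>-th coefficient. When \<open>K m m = 0\<close> the correction term is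
\<open>0\<close>, division by zero being zero, and the statement is trivial.\<close>

lemma psd_kernel_schur_complement:
  assumes K: "psd_kernel K"
  shows "psd_kernel (\<lambda>i j. K i j - K i m * K m j / K m m)"
proof (cases "K m m = 0")
  case False
  have sym: "K i j = K j i" for i j using psd_kernelD(1)[OF K] .
  have "0 \<le> (\<Sum>i\<in>A. \<Sum>j\<in>A. c i * c j * (K i j - K i m * K m j / K m m))" if A: "finite A" for A c
  proof -
    define b where "b = (\<Sum>i\<in>A. c i * K i m)"
    have b: "b = (\<Sum>j\<in>A. c j * K m j)"
      unfolding b_def by (intro sum.cong refl arg_cong2[of _ _ _ _ times] sym)
    define s where "s = b / K m m"
    define e where "e i = (if i \<in> A then c i else 0)" for i
    let ?B = "insert m A" and ?\<delta> = "\<lambda>i. of_bool (i = m) :: real"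
    have toB: "(\<Sum>i\<in>?B. e i * h i) = (\<Sum>i\<in>A. c i * h i)" for h
      using A by (intro sum.mono_neutral_cong_right) (auto simp: e_def)
    have delta: "(\<Sum>i\<in>?B. ?\<delta> i * h i) = h m" for h :: "_ \<Rightarrow> real"
      using A by (simp add: of_bool_def if_distrib[of "\<lambda>x. x * _"] cong: if_cong)
    have row: "(\<Sum>j\<in>?B. (e j - s * ?\<delta> j) * K i j) = (\<Sum>j\<in>A. c j * K i j) - s * K i m" for i
      using toB[of "K i"] delta[of "K i"]
      by (simp only: left_diff_distrib sum_subtractf mult.assoc flip: sum_distrib_left)
    have "0 \<le> (\<Sum>i\<in>?B. \<Sum>j\<in>?B. (e i - s * ?\<delta> i) * (e j - s * ?\<delta> j) * K i j)"
      using A by (intro psd_kernelD(2)[OF K]) simp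
    also have "\<dots> = (\<Sum>i\<in>?B. (e i - s * ?\<delta> i) * ((\<Sum>j\<in>A. c j * K i j) - s * K i m))"
      by (simp only: row[symmetric] sum_distrib_left mult.assoc)
    also have "\<dots> = (\<Sum>i\<in>A. c i * ((\<Sum>j\<in>A. c j * K i j) - s * K i m)) - s * ((\<Sum>j\<in>A. c j * K m j) - s * K m m)"
      using toB[of "\<lambda>i. (\<Sum>j\<in>A. c j * K i j) - s * K i m"] delta[of "\<lambda>i. (\<Sum>j\<in>A. c j * K i j) - s * K i m"]
      by (simp only: left_diff_distrib sum_subtractf mult.assoc flip: sum_distrib_left)
    also have "(\<Sum>j\<in>A. c j * K m j) = b" by (rule b[symmetric])
    also have "b - s * K m m = 0" using False by (simp add: s_def)
    also have "(\<Sum>i\<in>A. c i * ((\<Sum>j\<in>A. c j * K i j) - s * K i m)) - s * 0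
        = (\<Sum>i\<in>A. \<Sum>j\<in>A. c i * c j * K i j) - s * b"
      by (simp add: b_def right_diff_distrib sum_subtractf sum_distrib_left mult_ac)
    also have "s * b = (\<Sum>i\<in>A. \<Sum>j\<in>A. c i * c j * (K i m * K m j / K m m))"
    proof -
      have "s * b = (\<Sum>i\<in>A. c i * K i m) * (\<Sum>j\<in>A. c j * K m j) / K m m"
        using b by (simp add: s_def b_def)
      then show ?thesis
        unfolding sum_product sum_divide_distrib by (simp only: times_divide_eq_right mult_ac)
    qed
    finally show ?thesis by (simp add: right_diff_distrib sum_subtractf)
  qed
  then show ?thesis unfolding psd_kernel_def by (auto simp: sym mult.commute)
qed (use K in simp)

text \<open>The part of \<open>K\<close> that is left after symmetric Gaussian elimination of the indices below \<open>n\<close>.\<close>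

fun schur_residual :: "(nat \<Rightarrow> nat \<Rightarrow> real) \<Rightarrow> nat \<Rightarrow> nat \<Rightarrow> nat \<Rightarrow> real" where
  "schur_residual K 0 i j = K i j"
| "schur_residual K (Suc n) i j =
    schur_residual K n i j - schur_residual K n i n * schur_residual K n n j / schur_residual K n n n"

lemma psd_kernel_schur_residual:
  assumes "psd_kernel K"
  shows "psd_kernel (schur_residual K n)"
proof (induction n)
  case 0
  have "schur_residual K 0 = K" by (intro ext) simp
  then show ?case using assms by simp
next
  case (Suc n)
  have "schur_residual K (Suc n) = (\<lambda>i j. schur_residual K n i j
      - schur_residual K n i n * schur_residual K n n j / schur_residual K n n n)"
    by (intro ext) simp
  then show ?case using psd_kernel_schur_complement[OF Suc] by simp
qed

lemma schur_residual_eliminated: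
  assumes "psd_kernel K" "i < n"
  shows "schur_residual K n i j = 0"
  using assms(2)
proof (induction n arbitrary: j)
  case (Suc n)
  show ?case
  proof (cases "i = n")
    case True
    then show ?thesis
      using psd_kernel_zero_row[OF psd_kernel_schur_residual[OF assms(1)], of n n j]
      by (cases "schur_residual K n n n = 0") simp_all
  next
    case False
    then show ?thesis using Suc by simp
  qed
qed simp

text \<open>The infinite Cholesky factorisation. Each elimination step removes the rank-one kernel
\<open>v i m * v j m\<close>, so the partial sums telescope to \<open>K - schur_residual K n\<close>, and the residual vanishes
in row \<open>i\<close> as soon as \<open>i\<close> has been eliminated. The rows of the factor are finitely supported, hence
they lie in \<open>\<ell>\<^sub>2\<close> whatever the growth of \<open>K\<close>.\<close>

lemma psd_kernel_cholesky:
  assumes K: "psd_kernel (K :: nat \<Rightarrow> nat \<Rightarrow> real)"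
  obtains v where "\<And>i m. i < m \<Longrightarrow> v i m = 0"
    and "\<And>i j n. i < n \<Longrightarrow> K i j = (\<Sum>m<n. v i m * v j m)"
proof -
  let ?R = "schur_residual K"
  define v where "v i m = ?R m i m / sqrt (?R m m m)" for i m
  have prod: "v i m * v j m = ?R m i j - ?R (Suc m) i j" for i j m
    using psd_kernel_diag_nonneg[OF psd_kernel_schur_residual[OF K], of m m]
      psd_kernelD(1)[OF psd_kernel_schur_residual[OF K], of m j m]
    by (simp add: v_def)
  have tele: "(\<Sum>m<n. v i m * v j m) = K i j - ?R n i j" for i j n
    using sum_lessThan_telescope'[of "\<lambda>m. ?R m i j" n] unfolding prod by simp
  show ?thesis
  proof (rule that)
    show "v i m = 0" if "i < m" for i m
      using schur_residual_eliminated[OF K that] by (simp add: v_def)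
    show "K i j = (\<Sum>m<n. v i m * v j m)" if "i < n" for i j n
      using tele schur_residual_eliminated[OF K that] by simp
  qed
qed

text \<open>Every countable positive semidefinite kernel is a Gram matrix in \<open>\<ell>\<^sub>2\<close>; the distance formula is the
polarisation identity \<open>|v - w|\<^sup>2 = \<langle>v,v\<rangle> + \<langle>w,w\<rangle> - 2\<langle>v,w\<rangle>\<close>.\<close>

lemma psd_kernel_embeds_ell2:
  assumes K: "psd_kernel (K :: nat \<Rightarrow> nat \<Rightarrow> real)"
  obtains v where "\<And>i. v i \<in> ell2" "\<And>i j. ell2_dist (v i) (v j) = sqrt (K i i + K j j - 2 * K i j)"
proof -
  obtain v where v0: "\<And>i m. i < m \<Longrightarrow> v i m = 0"
    and v: "\<And>i j n. i < n \<Longrightarrow> K i j = (\<Sum>m<n. v i m * v j m)"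
    using psd_kernel_cholesky[OF K] by blast
  show ?thesis
  proof (rule that[of v])
    show "v i \<in> ell2" for i
    proof -
      have "(\<lambda>n. (v i n)\<^sup>2) summable_on UNIV \<longleftrightarrow> (\<lambda>n. (v i n)\<^sup>2) summable_on {..i}"
        by (intro summable_on_cong_neutral) (auto simp: v0)
      then show ?thesis by (simp add: ell2_def)
    qed
    fix i j
    let ?n = "Suc (max i j)"
    have "(\<Sum>\<^sub>\<infinity>m. (v i m - v j m)\<^sup>2) = (\<Sum>\<^sub>\<infinity>m\<in>{..<?n}. (v i m - v j m)\<^sup>2)"
      by (intro infsum_cong_neutral) (auto simp: v0)
    also have "\<dots> = (\<Sum>m<?n. v i m * v i m) + (\<Sum>m<?n. v j m * v j m) - 2 * (\<Sum>m<?n. v i m * v j m)"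
      by (simp add: power2_eq_square algebra_simps sum.distrib sum_subtractf
          flip: sum_distrib_left del: sum.lessThan_Suc)
    also have "\<dots> = K i i + K j j - 2 * K i j"
      using v[of i ?n i] v[of j ?n j] v[of i ?n j] by simp
    finally show "ell2_dist (v i) (v j) = sqrt (K i i + K j j - 2 * K i j)"
      by (simp add: ell2_dist_def)
  qed
qed

section \<open>The snowflake embedding of \<open>L\<^sub>p\<close> into \<open>\<ell>\<^sub>2\<close>\<close>

text \<open>The integrand of the Levy--Khinchin representation of \<open>|s| powr p\<close>, the exponent of a symmetric
\<open>p\<close>-stable law.\<close>

definition levy :: "real \<Rightarrow> real \<Rightarrow> real \<Rightarrow> real"
  where "levy p s u = (1 - cos (s * u)) * \<bar>u\<bar> powr (- 1 - p)"

lemma levy_nonneg: "0 \<le> levy p s u"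
  by (simp add: levy_def)

lemma borel_measurable_levy [measurable]: "levy p s \<in> borel_measurable borel"
  unfolding levy_def by measurable

lemma integrable_powr_near_0:
  assumes "-1 < (a::real)"
  shows "integrable lborel (\<lambda>x. indicator {0..1} x * x powr a)"
proof -
  have "(\<lambda>x. x powr a) absolutely_integrable_on {0..1}"
    using integrable_on_powr_from_0[OF assms, of 1] by (intro nonnegative_absolutely_integrable_1) auto
  then show ?thesis
    unfolding set_integrable_def by (subst (asm) integrable_completion) simp_all
qed

lemma integrable_powr_at_infinity:
  assumes "a < (-1::real)"
  shows "integrable lborel (\<lambda>x. indicator {1..} x * x powr a)"
proof -
  have "(\<lambda>x. x powr a) integrable_on {1..}"
    using has_integral_powr_to_inf[OF assms, of 1] by (auto simp: integrable_on_def)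
  then have "(\<lambda>x. x powr a) absolutely_integrable_on {1..}"
    by (intro nonnegative_absolutely_integrable_1) auto
  then show ?thesis
    unfolding set_integrable_def by (subst (asm) integrable_completion) simp_all
qed

lemma one_minus_cos_le_square: "1 - cos x \<le> x\<^sup>2" for x :: real
proof -
  have "1 - cos x = 2 * (sin (x / 2))\<^sup>2"
    using cos_double_sin[of "x / 2"] by simp
  also have "(sin (x / 2))\<^sup>2 \<le> (x / 2)\<^sup>2"
    using abs_sin_x_le_abs_x[of "x / 2"] by (metis abs_le_square_iff)
  also have "2 * (x / 2)\<^sup>2 \<le> x\<^sup>2" by (simp add: power2_eq_square)
  finally show ?thesis by simp
qed

text \<open>Here \<open>0 < p < 2\<close> enters: \<open>1 - cos u\<close> is of order \<open>u\<^sup>2\<close> near \<open>0\<close>, which leaves \<open>|u| powr (1 - p)\<close> and needs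
\<open>p < 2\<close>; it is bounded far from \<open>0\<close>, where \<open>|u| powr (- 1 - p)\<close> needs \<open>p > 0\<close>.\<close>

lemma integrable_levy_1:
  assumes p: "0 < p" "p < 2"
  shows "integrable lborel (levy p 1)"
proof -
  \<comment> \<open>a majorant on the half-line; on the whole line \<open>u \<mapsto> g u + g (- u)\<close> dominates the even integrand\<close>
  define g where "g u = indicator {0..1} u * u powr (1 - p) + 2 * (indicator {1..} u * u powr (- 1 - p))"
    for u :: real
  have g: "integrable lborel g"
    unfolding g_def using p
    by (intro Bochner_Integration.integrable_add integrable_mult_right
        integrable_powr_near_0 integrable_powr_at_infinity) auto
  have nn: "0 \<le> g u" for u by (simp add: g_def)
  have le: "levy p 1 u \<le> g \<bar>u\<bar>" for u
  proof (cases "\<bar>u\<bar> \<le> 1")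
    case True
    have "levy p 1 u \<le> u\<^sup>2 * \<bar>u\<bar> powr (- 1 - p)"
      using one_minus_cos_le_square[of u] by (simp add: levy_def mult_right_mono)
    also have "\<dots> = \<bar>u\<bar> powr (1 - p)"
    proof (cases "u = 0")
      case False
      then have "u\<^sup>2 = \<bar>u\<bar> powr 2" by simp
      then show ?thesis by (simp only: powr_add[symmetric]) simp
    qed simp
    also have "\<dots> \<le> g \<bar>u\<bar>" using True by (simp add: g_def)
    finally show ?thesis .
  next
    case False
    have "1 - cos u \<le> 2" using cos_ge_minus_one[of u] by linarith
    then have "levy p 1 u \<le> 2 * \<bar>u\<bar> powr (- 1 - p)"
      by (simp add: levy_def mult_right_mono)
    then show ?thesis using False by (simp add: g_def)
  qed
  have "integrable lborel (\<lambda>u. g u + g (- u))"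
    using g lborel_integrable_real_affine[OF g, of "-1" 0] by simp
  then show ?thesis
  proof (rule Bochner_Integration.integrable_bound)
    have "g \<bar>u\<bar> \<le> g u + g (- u)" for u using nn[of u] nn[of "- u"] by (cases "0 \<le> u") auto
    then show "AE u in lborel. norm (levy p 1 u) \<le> norm (g u + g (- u))"
      using le nn levy_nonneg[of p 1] by (auto intro!: AE_I2 order_trans[OF le])
  qed simp
qed

definition levy_const :: "real \<Rightarrow> real"
  where "levy_const p = (\<integral>u. levy p 1 u \<partial>lborel)"

lemma levy_const_pos:
  assumes p: "0 < p" "p < 2"
  shows "0 < levy_const p"
proof -
  have "levy_const p \<noteq> 0"
  proof
    assume "levy_const p = 0"
    then have "AE u in lborel. levy p 1 u = 0"
      using integral_nonneg_eq_0_iff_AE[OF integrable_levy_1[OF p]]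
      by (simp add: levy_const_def levy_nonneg)
    moreover have "levy p 1 u \<noteq> 0" if "u \<in> {1..2}" for u
      using cos_monotone_0_pi[of 0 u] that pi_gt3 by (auto simp: levy_def)
    ultimately have "AE u in lborel. u \<notin> {1..2::real}"
      by (auto elim: eventually_mono)
    then show False by (subst (asm) AE_iff_null_sets[symmetric]) (auto simp: null_sets_def)
  qed
  moreover have "0 \<le> levy_const p"
    unfolding levy_const_def by (intro integral_nonneg_AE AE_I2 levy_nonneg)
  ultimately show ?thesis by simp
qed

lemma levy_scale:
  assumes "s \<noteq> 0"
  shows "levy p s = (\<lambda>u. \<bar>s\<bar> powr (1 + p) * levy p 1 (0 + s * u))"
proof
  fix u
  have "\<bar>s\<bar> powr (1 + p) * \<bar>s\<bar> powr (- 1 - p) = 1"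
    using assms by (simp flip: powr_add)
  then show "levy p s u = \<bar>s\<bar> powr (1 + p) * levy p 1 (0 + s * u)"
    by (simp add: levy_def abs_mult powr_mult)
qed

text \<open>The substitution \<open>u \<mapsto> s * u\<close> shows that the integral is homogeneous of degree \<open>p\<close> in \<open>s\<close>.\<close>

lemma levy_has_integral:
  assumes p: "0 < p" "p < 2"
  shows "integrable lborel (levy p s)" "(\<integral>u. levy p s u \<partial>lborel) = levy_const p * \<bar>s\<bar> powr p"
proof -
  have "integrable lborel (levy p s) \<and> (\<integral>u. levy p s u \<partial>lborel) = levy_const p * \<bar>s\<bar> powr p"
  proof (cases "s = 0")
    case True
    moreover have "levy p 0 = (\<lambda>u. 0)" by (simp add: levy_def fun_eq_iff)
    ultimately show ?thesis by simp
  next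
    case False
    have int: "integrable lborel (\<lambda>u. levy p 1 (0 + s * u))"
      using lborel_integrable_real_affine[OF integrable_levy_1[OF p] False] .
    have "levy_const p = \<bar>s\<bar> * (\<integral>u. levy p 1 (0 + s * u) \<partial>lborel)"
      unfolding levy_const_def using lborel_integral_real_affine[OF False, of "levy p 1" 0] by simp
    moreover have "\<bar>s\<bar> powr (1 + p) = \<bar>s\<bar> * \<bar>s\<bar> powr p"
      using False by (simp add: powr_add)
    ultimately show ?thesis
      using int by (simp add: levy_scale[OF False])
  qed
  then show "integrable lborel (levy p s)" "(\<integral>u. levy p s u \<partial>lborel) = levy_const p * \<bar>s\<bar> powr p"
    by blast+
qed

text \<open>By the Levy--Khinchin representation it suffices to treat \<open>1 - cos (s * u)\<close> in place of \<open>|s| powr p\<close>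
for each fixed \<open>u\<close>. There the addition formula for the cosine turns
\<open>(1 - cos x) + (1 - cos y) - (1 - cos (x - y))\<close> into the sum
\<open>(1 - cos x) * (1 - cos y) + sin x * sin y\<close> of two rank-one kernels.\<close>

lemma psd_kernel_powr:
  fixes a :: "'i \<Rightarrow> real"
  assumes p: "0 < p" "p < 2"
  shows "psd_kernel (\<lambda>i j. \<bar>a i\<bar> powr p + \<bar>a j\<bar> powr p - \<bar>a i - a j\<bar> powr p)"
proof -
  define L where "L u i j = levy p (a i) u + levy p (a j) u - levy p (a i - a j) u" for u i j
  have L: "L u = (\<lambda>i j. \<bar>u\<bar> powr (- 1 - p) *
      ((1 - cos (a i * u)) * (1 - cos (a j * u)) + sin (a i * u) * sin (a j * u)))" for u
    by (intro ext) (simp add: L_def levy_def left_diff_distrib cos_diff algebra_simps)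
  have psd: "psd_kernel (L u)" for u
    unfolding L by (intro psd_kernel_scale psd_kernel_add psd_kernel_rank_one) simp
  have "psd_kernel (\<lambda>i j. \<integral>u. L u i j \<partial>lborel)"
    by (rule psd_kernel_integral[OF psd]) (simp add: L_def levy_has_integral[OF p])
  then have "psd_kernel (\<lambda>i j. (1 / levy_const p) * (\<integral>u. L u i j \<partial>lborel))"
    using levy_const_pos[OF p] by (intro psd_kernel_scale) auto
  moreover have "(1 / levy_const p) * (\<integral>u. L u i j \<partial>lborel)
      = \<bar>a i\<bar> powr p + \<bar>a j\<bar> powr p - \<bar>a i - a j\<bar> powr p" for i j
    using levy_const_pos[OF p] by (simp add: L_def levy_has_integral[OF p] field_simps)
  ultimately show ?thesis by simp
qed

text \<open>Integrating the scalar kernel over \<open>M\<close> shows that half of \<open>\<parallel>f\<parallel>\<^sup>p + \<parallel>g\<parallel>\<^sup>p - \<parallel>f - g\<parallel>\<^sup>p\<close> is a positive semidefinite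
kernel on \<open>L\<^sub>p\<close>. In its Gram representation the squared distance of two functions is \<open>\<parallel>f - g\<parallel>\<^sup>p\<close>, so the
snowflaked metric \<open>\<parallel>f - g\<parallel> powr (p / 2)\<close> is Euclidean.\<close>

lemma Lp_functions_embed_ell2:
  fixes f :: "nat \<Rightarrow> 'a \<Rightarrow> real"
  assumes p: "1 \<le> p" "p < 2" and f: "\<And>i. f i \<in> Lp_functions M p"
  shows "\<exists>v. (\<forall>i. v i \<in> ell2) \<and>
    (\<forall>i j. ell2_dist (v i) (v j) = Lp_norm M p (\<lambda>x. f i x - f j x) powr (p / 2))"
proof -
  let ?I = "\<lambda>g. \<integral>x. \<bar>g x\<bar> powr p \<partial>M"
  let ?k = "\<lambda>x i j. \<bar>f i x\<bar> powr p + \<bar>f j x\<bar> powr p - \<bar>f i x - f j x\<bar> powr p"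
  define K where "K i j = (1 / 2) * (\<integral>x. ?k x i j \<partial>M)" for i j
  have int: "integrable M (\<lambda>x. \<bar>f i x\<bar> powr p)" "integrable M (\<lambda>x. \<bar>f i x - f j x\<bar> powr p)" for i j
    using f Lp_functions_diff[OF p(1) f f] by (auto simp: Lp_functions_def)
  have "psd_kernel (\<lambda>i j. \<integral>x. ?k x i j \<partial>M)"
    using p int by (intro psd_kernel_integral psd_kernel_powr) auto
  then have "psd_kernel K" unfolding K_def by (intro psd_kernel_scale) auto
  then obtain v where v: "\<And>i. v i \<in> ell2"
      "\<And>i j. ell2_dist (v i) (v j) = sqrt (K i i + K j j - 2 * K i j)"
    using psd_kernel_embeds_ell2 by blast
  have "ell2_dist (v i) (v j) = Lp_norm M p (\<lambda>x. f i x - f j x) powr (p / 2)" for i j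
  proof -
    have "K i i + K j j - 2 * K i j = ?I (\<lambda>x. f i x - f j x)"
      using p int by (simp add: K_def field_simps)
    also have "\<dots> = Lp_norm M p (\<lambda>x. f i x - f j x) powr p"
      using p by (simp add: Lp_norm_powr)
    finally show ?thesis
      by (simp add: v(2) Lp_norm_nonneg powr_half_sqrt_powr)
  qed
  then show ?thesis using v(1) by (intro exI[of _ v] conjI allI)
qed

section \<open>Rademacher sums and Khinchin's inequality\<close>

abbreviation unit_interval :: "real measure"
  where "unit_interval \<equiv> lebesgue_on {0<..<1}"

lemma finite_measure_unit_interval: "finite_measure unit_interval"
  by (intro finite_measureI) (simp add: space_restrict_space emeasure_restrict_space)

lemma measure_unit_interval [simp]: "measure unit_interval {0<..<1} = 1"
  by (simp add: measure_restrict_space)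

lemma measurable_unit_interval:
  "f \<in> borel_measurable borel \<Longrightarrow> f \<in> borel_measurable unit_interval"
  by (intro measurable_restrict_space1 measurable_completion) simp

lemma integrable_unit_interval_bounded:
  fixes f :: "real \<Rightarrow> real"
  assumes "f \<in> borel_measurable borel" "\<And>t. \<bar>f t\<bar> \<le> B"
  shows "integrable unit_interval f"
  using assms by (intro finite_measure.integrable_const_bound[OF finite_measure_unit_interval, of _ B]
      measurable_unit_interval) auto

text \<open>The half-open interval makes the pieces that arise when the interval is translated and cut fit together
exactly.\<close>

lemma integral_unit_interval:
  fixes f :: "real \<Rightarrow> real"
  assumes [measurable]: "f \<in> borel_measurable borel"
  shows "(\<integral>t. f t \<partial>unit_interval) = (\<integral>t. indicator {0..<1} t * f t \<partial>lborel)"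
proof -
  have "(\<integral>t. f t \<partial>unit_interval) = (\<integral>t. indicator {0<..<1} t * f t \<partial>lebesgue)"
    by (simp add: integral_restrict_space)
  also have "\<dots> = (\<integral>t. indicator {0<..<1} t * f t \<partial>lborel)"
    by (intro integral_completion) measurable
  also have "\<dots> = (\<integral>t. indicator {0..<1} t * f t \<partial>lborel)"
  proof (rule integral_cong_AE)
    show "AE t in lborel. indicator {0<..<1} t * f t = indicator {0..<1} t * f t"
      using AE_lborel_singleton[of "0 :: real"] by eventually_elim (auto simp: indicator_def)
  qed measurable
  finally show ?thesis .
qed

text \<open>A rotation of the circle preserves Lebesgue measure: the piece that leaves the interval at one end
re-enters at the other by periodicity.\<close>

lemma integral_unit_interval_shift:
  fixes f :: "real \<Rightarrow> real"
  assumes [measurable]: "f \<in> borel_measurable borel" and bound: "\<And>t. \<bar>f t\<bar> \<le> B"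
    and periodic: "\<And>t. f (t + 1) = f t" and h: "0 \<le> h" "h \<le> 1"
  shows "(\<integral>t. f (t + h) \<partial>unit_interval) = (\<integral>t. f t \<partial>unit_interval)"
proof -
  have int: "integrable lborel (\<lambda>t. indicator {a..<b} t * f t)" for a b
  proof (rule Bochner_Integration.integrable_bound)
    show "integrable lborel (\<lambda>t. indicator {a..b} t * B)"
      by (intro integrable_mult_left integrable_real_indicator) (auto simp: emeasure_lborel_Icc_eq)
    show "AE t in lborel. norm (indicator {a..<b} t * f t) \<le> norm (indicator {a..b} t * B)"
      using bound by (auto simp: indicator_def intro!: AE_I2 order_trans[OF bound])
  qed measurable
  have "(\<integral>t. f (t + h) \<partial>unit_interval) = (\<integral>t. indicator {0..<1} t * f (t + h) \<partial>lborel)"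
    by (intro integral_unit_interval) measurable
  also have "\<dots> = (\<integral>t. indicator {h..<1+h} t * f t \<partial>lborel)"
    using lborel_integral_real_affine[of 1 "\<lambda>t. indicator {h..<1+h} t * f t" h]
    by (simp add: add.commute indicator_def)
  also have "\<dots> = (\<integral>t. indicator {h..<1} t * f t + indicator {1..<1+h} t * f t \<partial>lborel)"
    using h by (intro Bochner_Integration.integral_cong) (auto simp: indicator_def)
  also have "\<dots> = (\<integral>t. indicator {h..<1} t * f t \<partial>lborel) + (\<integral>t. indicator {1..<1+h} t * f t \<partial>lborel)"
    by (intro Bochner_Integration.integral_add int)
  also have "(\<integral>t. indicator {1..<1+h} t * f t \<partial>lborel) = (\<integral>t. indicator {0..<h} t * f t \<partial>lborel)"
    using lborel_integral_real_affine[of 1 "\<lambda>t. indicator {1..<1+h} t * f t" 1] periodic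
    by (simp add: add.commute indicator_def)
  also have "(\<integral>t. indicator {h..<1} t * f t \<partial>lborel) + (\<integral>t. indicator {0..<h} t * f t \<partial>lborel)
      = (\<integral>t. indicator {h..<1} t * f t + indicator {0..<h} t * f t \<partial>lborel)"
    by (intro Bochner_Integration.integral_add[symmetric] int)
  also have "\<dots> = (\<integral>t. indicator {0..<1} t * f t \<partial>lborel)"
    using h by (intro Bochner_Integration.integral_cong) (auto simp: indicator_def)
  also have "\<dots> = (\<integral>t. f t \<partial>unit_interval)"
    by (intro integral_unit_interval[symmetric]) measurable
  finally show ?thesis .
qed

text \<open>The sign records the binary digit of \<open>t\<close> at position \<open>n + 1\<close> after the point.\<close>

definition rademacher :: "nat \<Rightarrow> real \<Rightarrow> real"
  where "rademacher n t = (if even \<lfloor>2 ^ Suc n * t\<rfloor> then 1 else - 1)"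

lemma borel_measurable_rademacher [measurable]: "rademacher n \<in> borel_measurable borel"
  unfolding rademacher_def by measurable

lemma abs_rademacher [simp]: "\<bar>rademacher n t\<bar> = 1"
  by (simp add: rademacher_def)

lemma rademacher_square [simp]: "rademacher n t * rademacher n t = 1"
  by (simp add: rademacher_def)

text \<open>Rotating by half a period of \<open>rademacher n\<close> flips its sign and is a whole number of periods for all
Rademacher functions of higher index. This symmetry takes the place of independence.\<close>

lemma rademacher_shift:
  "rademacher k (t + 1 / 2 ^ Suc n) = (if k = n then - rademacher k t else rademacher k t)"
  if "n \<le> k"
proof -
  have "2 ^ Suc k * (t + 1 / 2 ^ Suc n) = 2 ^ Suc k * t + of_int (2 ^ (k - n))"
  proof -
    have "(2::real) ^ k = 2 ^ n * 2 ^ (k - n)" using that by (simp flip: power_add)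
    then show ?thesis by (simp add: field_simps)
  qed
  then have "\<lfloor>2 ^ Suc k * (t + 1 / 2 ^ Suc n)\<rfloor> = \<lfloor>2 ^ Suc k * t\<rfloor> + 2 ^ (k - n)"
    by (simp only: floor_add_int)
  then show ?thesis using that unfolding rademacher_def by auto
qed

lemma rademacher_periodic: "rademacher k (t + 1) = rademacher k t"
proof -
  have "2 ^ Suc k * (t + 1) = 2 ^ Suc k * t + of_int (2 ^ Suc k)"
    by (simp add: field_simps)
  then have "\<lfloor>2 ^ Suc k * (t + 1)\<rfloor> = \<lfloor>2 ^ Suc k * t\<rfloor> + 2 ^ Suc k"
    by (simp only: floor_add_int)
  then show ?thesis unfolding rademacher_def by simp
qed

definition rademacher_sum :: "nat set \<Rightarrow> (nat \<Rightarrow> real) \<Rightarrow> real \<Rightarrow> real"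
  where "rademacher_sum A c t = (\<Sum>n\<in>A. c n * rademacher n t)"

lemma borel_measurable_rademacher_sum [measurable]: "rademacher_sum A c \<in> borel_measurable borel"
  unfolding rademacher_sum_def by measurable

lemma abs_rademacher_sum_le: "\<bar>rademacher_sum A c t\<bar> \<le> (\<Sum>n\<in>A. \<bar>c n\<bar>)"
  unfolding rademacher_sum_def by (rule order_trans[OF sum_abs]) (simp add: abs_mult)

lemma integrable_rademacher_sum_power: "integrable unit_interval (\<lambda>t. rademacher_sum A c t ^ k)"
proof (rule integrable_unit_interval_bounded)
  show "\<bar>rademacher_sum A c t ^ k\<bar> \<le> (\<Sum>n\<in>A. \<bar>c n\<bar>) ^ k" for t
    using abs_rademacher_sum_le[of A c t] by (simp add: power_abs power_mono)
qed measurable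

text \<open>The integrand changes sign under rotation by \<open>1 / 2 ^ Suc b\<close>, while its integral is invariant under
rotations.\<close>

lemma integral_rademacher_mult_power:
  assumes "\<forall>a\<in>A. b < a"
  shows "integrable unit_interval (\<lambda>t. rademacher b t * rademacher_sum A c t ^ k)"
    and "(\<integral>t. rademacher b t * rademacher_sum A c t ^ k \<partial>unit_interval) = 0"
proof -
  let ?f = "\<lambda>t. rademacher b t * rademacher_sum A c t ^ k"
  have bound: "\<bar>?f t\<bar> \<le> (\<Sum>n\<in>A. \<bar>c n\<bar>) ^ k" for t
    using abs_rademacher_sum_le[of A c t] by (simp add: abs_mult power_abs power_mono)
  show "integrable unit_interval ?f"
    by (rule integrable_unit_interval_bounded[OF _ bound]) measurable
  have shift: "?f (t + 1 / 2 ^ Suc b) = - ?f t" for t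
  proof -
    have "rademacher_sum A c (t + 1 / 2 ^ Suc b) = rademacher_sum A c t"
      unfolding rademacher_sum_def using assms by (intro sum.cong) (auto simp: rademacher_shift simp del: power_Suc)
    then show ?thesis by (simp add: rademacher_shift del: power_Suc)
  qed
  have "(\<integral>t. ?f (t + 1 / 2 ^ Suc b) \<partial>unit_interval) = (\<integral>t. ?f t \<partial>unit_interval)"
  proof (rule integral_unit_interval_shift[OF _ bound])
    show "(1::real) / 2 ^ Suc b \<le> 1" using one_le_power[of "2::real" "Suc b"] by (simp del: power_Suc)
  qed (measurable, simp_all add: rademacher_sum_def rademacher_periodic)
  then show "(\<integral>t. ?f t \<partial>unit_interval) = 0"
    unfolding shift by simp
qed

text \<open>The functions are added in order of decreasing index, so that the new one always has the least index
and its odd powers integrate to zero against the old sum. With \<open>x\<close> the new coefficient and \<open>q\<close> the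
old sum of squares, the fourth moment then obeys \<open>x^4 + 6 x\<^sup>2 q + 3 q\<^sup>2 \<le> 3 (x\<^sup>2 + q)\<^sup>2\<close>.\<close>

lemma rademacher_sum_moments:
  assumes "finite A"
  shows "(\<integral>t. rademacher_sum A c t ^ 2 \<partial>unit_interval) = (\<Sum>n\<in>A. (c n)\<^sup>2)"
    and "(\<integral>t. rademacher_sum A c t ^ 4 \<partial>unit_interval) \<le> 3 * (\<Sum>n\<in>A. (c n)\<^sup>2)\<^sup>2"
proof -
  let ?E = "\<lambda>f. \<integral>t. f t \<partial>unit_interval"
  have "?E (\<lambda>t. rademacher_sum A c t ^ 2) = (\<Sum>n\<in>A. (c n)\<^sup>2) \<and>
      ?E (\<lambda>t. rademacher_sum A c t ^ 4) \<le> 3 * (\<Sum>n\<in>A. (c n)\<^sup>2)\<^sup>2"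
    using assms
  proof (induction A rule: finite_linorder_min_induct)
    case empty
    then show ?case by (simp add: rademacher_sum_def)
  next
    case (insert b A)
    let ?S = "rademacher_sum A c" and ?x = "c b" and ?q = "\<Sum>n\<in>A. (c n)\<^sup>2"
    have notin: "b \<notin> A" using insert.hyps(2) by auto
    have S: "rademacher_sum (insert b A) c t = ?x * rademacher b t + ?S t" for t
      using insert.hyps(1) notin by (simp add: rademacher_sum_def)
    have sq: "rademacher b t * (rademacher b t * y) = y" for t y
      by (simp flip: mult.assoc)
    have e2: "rademacher_sum (insert b A) c t ^ 2
        = ?x\<^sup>2 + 2 * ?x * (rademacher b t * ?S t ^ 1) + ?S t ^ 2" for t
      unfolding S by (simp add: power2_eq_square algebra_simps sq)
    have e4: "rademacher_sum (insert b A) c t ^ 4 = ?x ^ 4 + 4 * ?x ^ 3 * (rademacher b t * ?S t ^ 1)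
        + 6 * ?x\<^sup>2 * ?S t ^ 2 + 4 * ?x * (rademacher b t * ?S t ^ 3) + ?S t ^ 4" for t
      unfolding S by (simp add: power2_eq_square power3_eq_cube power4_eq_xxxx algebra_simps sq)
    note int = integrable_rademacher_sum_power[of A c] integral_rademacher_mult_power[OF insert.hyps(2), of c]
      finite_measure.integrable_const[OF finite_measure_unit_interval]
    have "?E (\<lambda>t. rademacher_sum (insert b A) c t ^ 2) = ?x\<^sup>2 + ?q"
      unfolding e2 using insert.IH
      by (simp add: int del: power_one_right One_nat_def)
    moreover have "?E (\<lambda>t. rademacher_sum (insert b A) c t ^ 4)
        = ?x ^ 4 + 6 * ?x\<^sup>2 * ?q + ?E (\<lambda>t. ?S t ^ 4)"
      unfolding e4 using insert.IH
      by (simp add: int del: power_one_right One_nat_def)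
    moreover have "?x ^ 4 + 6 * ?x\<^sup>2 * ?q + 3 * ?q\<^sup>2 \<le> 3 * (?x\<^sup>2 + ?q)\<^sup>2"
      using zero_le_power2[of "?x\<^sup>2"]
      by (simp add: power2_eq_square power4_eq_xxxx algebra_simps)
    ultimately show ?case using insert notin by simp
  qed
  then show "?E (\<lambda>t. rademacher_sum A c t ^ 2) = (\<Sum>n\<in>A. (c n)\<^sup>2)"
    and "?E (\<lambda>t. rademacher_sum A c t ^ 4) \<le> 3 * (\<Sum>n\<in>A. (c n)\<^sup>2)\<^sup>2" by blast+
qed

text \<open>This pointwise inequality replaces Hoelder's inequality in the lower Khinchin bound. The coefficient
\<open>1/4\<close> is small enough for a positive lower bound to survive integration: second moment \<open>1\<close> and
fourth moment at most \<open>3\<close> give \<open>1 - 3/4 = 1/4\<close>.\<close>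

lemma square_le_powr_plus_fourth_power:
  fixes y p :: real
  assumes "1 \<le> p" "p \<le> 2"
  shows "y\<^sup>2 - y ^ 4 / 4 \<le> 2 * \<bar>y\<bar> powr p"
proof (cases "\<bar>y\<bar> \<le> 2")
  case True
  have "\<bar>y\<bar> * \<bar>y\<bar> \<le> 2 * \<bar>y\<bar> powr p"
  proof (cases "\<bar>y\<bar> \<le> 1")
    case True
    have "\<bar>y\<bar> powr 2 \<le> \<bar>y\<bar> powr p"
      using True assms by (intro powr_mono') auto
    then have "\<bar>y\<bar> * \<bar>y\<bar> \<le> 1 * \<bar>y\<bar> powr p" by (simp add: power2_eq_square)
    also have "\<dots> \<le> 2 * \<bar>y\<bar> powr p" by (intro mult_right_mono) auto
    finally show ?thesis .
  next
    case False
    have "\<bar>y\<bar> powr 1 \<le> \<bar>y\<bar> powr p"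
      using False assms by (intro powr_mono) auto
    then show ?thesis using True mult_mono[of "\<bar>y\<bar>" 2 "\<bar>y\<bar>" "\<bar>y\<bar> powr p"] False by simp
  qed
  moreover have "0 \<le> y ^ 4" by simp
  ultimately show ?thesis unfolding power2_eq_square abs_mult_self_eq by linarith
next
  case False
  then have "2\<^sup>2 \<le> \<bar>y\<bar>\<^sup>2" by (intro power_mono) auto
  then have "y\<^sup>2 * 4 \<le> y\<^sup>2 * y\<^sup>2" by (intro mult_left_mono) auto
  then have "y\<^sup>2 - y ^ 4 / 4 \<le> 0" by (simp add: power4_eq_xxxx power2_eq_square mult.assoc)
  then show ?thesis by (smt (verit) powr_ge_zero)
qed

lemma powr_le_one_plus_square:
  fixes y p :: real
  assumes "0 \<le> p" "p \<le> 2"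
  shows "\<bar>y\<bar> powr p \<le> 1 + y\<^sup>2"
proof (cases "\<bar>y\<bar> \<le> 1")
  case True
  have "\<bar>y\<bar> powr p \<le> 1" using True assms by (simp add: powr_le1)
  then show ?thesis by (smt (verit) zero_le_power2)
next
  case False
  have "\<bar>y\<bar> powr p \<le> \<bar>y\<bar> powr 2" using False assms by (intro powr_mono) auto
  then show ?thesis using False by simp
qed

lemma rademacher_sum_Lp: "0 \<le> p \<Longrightarrow> rademacher_sum A c \<in> Lp_functions unit_interval p"
  unfolding Lp_functions_def
proof (intro CollectI conjI measurable_unit_interval borel_measurable_rademacher_sum)
  assume p: "0 \<le> p"
  show "integrable unit_interval (\<lambda>t. \<bar>rademacher_sum A c t\<bar> powr p)"
  proof (rule integrable_unit_interval_bounded)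
    show "\<bar>\<bar>rademacher_sum A c t\<bar> powr p\<bar> \<le> (\<Sum>n\<in>A. \<bar>c n\<bar>) powr p" for t
      using p abs_rademacher_sum_le[of A c t] by (simp add: powr_mono2)
  qed measurable
qed

lemma Lp_norm_scale:
  assumes "0 < p"
  shows "Lp_norm M p (\<lambda>x. s * f x) = \<bar>s\<bar> * Lp_norm M p f"
proof -
  have "(\<integral>x. \<bar>s * f x\<bar> powr p \<partial>M) = \<bar>s\<bar> powr p * (\<integral>x. \<bar>f x\<bar> powr p \<partial>M)"
    by (simp add: abs_mult powr_mult)
  then show ?thesis
    using assms by (simp add: Lp_norm_def powr_mult powr_powr)
qed

text \<open>Khinchin's inequality, with the constants that result from integrating the two pointwise inequalities
above.\<close>

lemma khinchin_normalized:
  assumes p: "1 \<le> p" "p \<le> 2" and A: "finite A" and c: "(\<Sum>n\<in>A. (c n)\<^sup>2) = 1"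
  shows "1 / 8 \<le> Lp_norm unit_interval p (rademacher_sum A c)"
    and "Lp_norm unit_interval p (rademacher_sum A c) \<le> 2"
proof -
  let ?S = "rademacher_sum A c" and ?E = "\<lambda>f. \<integral>t. f t \<partial>unit_interval"
  define I where "I = ?E (\<lambda>t. \<bar>?S t\<bar> powr p)"
  have intp: "integrable unit_interval (\<lambda>t. \<bar>?S t\<bar> powr p)"
    using rademacher_sum_Lp[of p A c] p by (simp add: Lp_functions_def)
  note int = integrable_rademacher_sum_power[of A c] intp
    finite_measure.integrable_const[OF finite_measure_unit_interval]
  have "?E (\<lambda>t. ?S t ^ 2 - ?S t ^ 4 / 4) \<le> ?E (\<lambda>t. 2 * \<bar>?S t\<bar> powr p)"
    using p by (intro integral_mono square_le_powr_plus_fourth_power) (simp_all add: int)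
  then have lower: "1 / 8 \<le> I"
    using rademacher_sum_moments[OF A, of c] c by (simp add: int I_def)
  have "I \<le> ?E (\<lambda>t. 1 + ?S t ^ 2)"
    unfolding I_def using p by (intro integral_mono powr_le_one_plus_square) (simp_all add: int)
  then have upper: "I \<le> 2"
    using rademacher_sum_moments(1)[OF A, of c] c by (simp add: int)
  have norm: "Lp_norm unit_interval p ?S = I powr (1 / p)"
    by (simp add: Lp_norm_def I_def)
  have "1 / 8 = (1 / 8) powr (1::real)" by simp
  also have "\<dots> \<le> (1 / 8) powr (1 / p)"
    using p by (intro powr_mono') auto
  also have "\<dots> \<le> I powr (1 / p)"
    using p lower by (intro powr_mono2) auto
  finally show "1 / 8 \<le> Lp_norm unit_interval p ?S" unfolding norm .
  have "I powr (1 / p) \<le> 2 powr (1 / p)"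
    using p lower upper by (intro powr_mono2) auto
  also have "\<dots> \<le> 2 powr 1"
    using p by (intro powr_mono) auto
  finally show "Lp_norm unit_interval p ?S \<le> 2" unfolding norm by simp
qed

lemma khinchin:
  assumes p: "1 \<le> p" "p \<le> 2" and A: "finite A"
  shows "sqrt (\<Sum>n\<in>A. (c n)\<^sup>2) / 8 \<le> Lp_norm unit_interval p (rademacher_sum A c)"
    and "Lp_norm unit_interval p (rademacher_sum A c) \<le> 2 * sqrt (\<Sum>n\<in>A. (c n)\<^sup>2)"
proof -
  define s where "s = sqrt (\<Sum>n\<in>A. (c n)\<^sup>2)"
  have "s / 8 \<le> Lp_norm unit_interval p (rademacher_sum A c) \<and>
      Lp_norm unit_interval p (rademacher_sum A c) \<le> 2 * s"
  proof (cases "s = 0")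
    case True
    then have "\<forall>n\<in>A. c n = 0"
      using A by (simp add: s_def sum_nonneg_eq_0_iff)
    then have "rademacher_sum A c = (\<lambda>t. 0)"
      by (simp add: rademacher_sum_def fun_eq_iff)
    then show ?thesis using True p by (simp add: Lp_norm_def)
  next
    case False
    have "0 \<le> s" by (simp add: s_def sum_nonneg)
    then have s: "0 < s" using False by simp
    have s2: "s\<^sup>2 = (\<Sum>n\<in>A. (c n)\<^sup>2)" by (simp add: s_def sum_nonneg)
    have "(\<Sum>n\<in>A. (c n / s)\<^sup>2) = (\<Sum>n\<in>A. (c n)\<^sup>2) / s\<^sup>2"
      by (simp add: power_divide sum_divide_distrib)
    also have "\<dots> = 1" using s by (simp flip: s2)
    finally have 1: "(\<Sum>n\<in>A. (c n / s)\<^sup>2) = 1" .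
    have "rademacher_sum A c = (\<lambda>t. s * rademacher_sum A (\<lambda>n. c n / s) t)"
      using s by (simp add: rademacher_sum_def fun_eq_iff sum_distrib_left)
    then have "Lp_norm unit_interval p (rademacher_sum A c)
        = s * Lp_norm unit_interval p (rademacher_sum A (\<lambda>n. c n / s))"
      using p s by (simp add: Lp_norm_scale)
    then show ?thesis
      using khinchin_normalized[OF p A 1] s by simp
  qed
  then show "sqrt (\<Sum>n\<in>A. (c n)\<^sup>2) / 8 \<le> Lp_norm unit_interval p (rademacher_sum A c)"
    and "Lp_norm unit_interval p (rademacher_sum A c) \<le> 2 * sqrt (\<Sum>n\<in>A. (c n)\<^sup>2)"
    by (simp_all add: s_def)
qed

section \<open>Coarse embeddability into \<open>\<ell>\<^sub>2\<close> and \<open>L\<^sub>p\<close>\<close>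

lemma Lp_space_representative:
  assumes "F \<in> Lp_space M p"
  shows "(SOME f. f \<in> F) \<in> Lp_functions M p"
proof -
  obtain f where f: "f \<in> Lp_functions M p" "F = Lp_rel M p `` {f}"
    using assms by (auto simp: Lp_space_def elim!: quotientE)
  have "f \<in> F" using equiv_class_self[OF equiv_Lp_rel f(1)] f(2) by simp
  then have "(SOME f. f \<in> F) \<in> F" by (rule someI[where P = "\<lambda>f. f \<in> F"])
  then show ?thesis unfolding f(2) by (auto simp: Lp_rel_def)
qed

text \<open>After passing to a countable net only countably many elements of \<open>L\<^sub>p\<close> occur, and these embed into
\<open>\<ell>\<^sub>2\<close> with distances raised to the power \<open>p / 2\<close>, which is a coarse change of the metric.\<close>

lemma coarsely_embeddable_ell2_if_Lp:
  fixes X :: "'a set"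
  assumes X: "Metric_space X d" "separable_space (Metric_space.mtopology X d)"
    and p: "1 \<le> p" "p < 2"
    and emb: "coarsely_embeddable X d (Lp_space M p) (Lp_dist M p)"
  shows "coarsely_embeddable X d ell2 ell2_dist"
proof -
  obtain f where f: "coarse_embedding X d (Lp_space M p) (Lp_dist M p) f"
    using emb by (auto simp: coarsely_embeddable_def)
  obtain C \<pi> where C: "countable C" "C \<subseteq> X" "\<pi> \<in> X \<rightarrow> C" "\<And>x. x \<in> X \<Longrightarrow> d x (\<pi> x) \<le> 1"
    using separable_countable_net[OF X] by blast
  have f\<pi>: "coarse_embedding X d (Lp_space M p) (Lp_dist M p) (\<lambda>x. f (\<pi> x))"
    using C by (intro coarse_embedding_perturb_source[OF X(1) f]) auto
  define rep where "rep x = (SOME h. h \<in> f x)" for x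
  \<comment> \<open>representatives of the net, enumerated; the value \<open>0\<close> at unused indices keeps every \<open>h i\<close> in \<open>L\<^sub>p\<close>\<close>
  define h where "h i = (if i \<in> to_nat_on C ` C then rep (from_nat_into C i) else (\<lambda>_. 0))" for i
  have h_Lp: "h i \<in> Lp_functions M p" for i
  proof (cases "i \<in> to_nat_on C ` C")
    case True
    then have "from_nat_into C i \<in> X" using C(1,2) by auto
    then have "f (from_nat_into C i) \<in> Lp_space M p"
      using f by (auto simp: coarse_embedding_def)
    then show ?thesis using True by (simp add: h_def rep_def Lp_space_representative)
  qed (use p in \<open>simp add: h_def Lp_functions_def\<close>)
  obtain v where v: "\<forall>i. v i \<in> ell2"
    "\<forall>i j. ell2_dist (v i) (v j) = Lp_norm M p (\<lambda>t. h i t - h j t) powr (p / 2)"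
    using Lp_functions_embed_ell2[OF p, of h M, OF h_Lp] by (elim exE conjE)
  let ?g = "\<lambda>x. v (to_nat_on C (\<pi> x))"
  have dist: "ell2_dist (?g x) (?g y) = Lp_dist M p (f (\<pi> x)) (f (\<pi> y)) powr (p / 2)"
    if "x \<in> X" "y \<in> X" for x y
  proof -
    have "h (to_nat_on C z) = rep z" if "z \<in> C" for z
      using that C(1) by (simp add: h_def)
    moreover have "\<pi> x \<in> C" "\<pi> y \<in> C" using that C(3) by auto
    ultimately show ?thesis by (simp add: v(2) Lp_dist_def rep_def)
  qed
  have mono: "mono_on {0..} (\<lambda>t. t powr (p / 2))"
    using p by (auto simp: monotone_on_def intro!: powr_mono2)
  have "coarse_embedding X d ell2 ell2_dist ?g"
  proof (rule coarse_embedding_control_target[OF X(1) f\<pi>])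
    show "filterlim (\<lambda>t. t powr (p / 2)) at_top (at_top :: real filter)"
      using p by (intro real_powr_at_top) auto
  qed (use v(1) dist mono in auto)
  then show ?thesis by (auto simp: coarsely_embeddable_def)
qed

lemma ell2_finite_support_approx:
  assumes "x \<in> ell2"
  obtains A where "finite A" "(\<lambda>n. if n \<in> A then x n else 0) \<in> ell2"
    "ell2_dist x (\<lambda>n. if n \<in> A then x n else 0) \<le> 1"
proof -
  have s: "(\<lambda>n. (x n)\<^sup>2) summable_on UNIV" using assms by (simp add: ell2_def)
  obtain A where A: "finite A" "dist (\<Sum>n\<in>A. (x n)\<^sup>2) (\<Sum>\<^sub>\<infinity>n. (x n)\<^sup>2) \<le> 1"
    using infsum_finite_approximation[OF s, of 1] by auto
  let ?y = "\<lambda>n. if n \<in> A then x n else 0"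
  have y: "?y \<in> ell2"
  proof -
    have "(\<lambda>n. (?y n)\<^sup>2) summable_on UNIV \<longleftrightarrow> (\<lambda>n. (?y n)\<^sup>2) summable_on A"
      by (intro summable_on_cong_neutral) auto
    then show ?thesis using A(1) by (simp add: ell2_def)
  qed
  have "(\<Sum>\<^sub>\<infinity>n. (x n - ?y n)\<^sup>2) = (\<Sum>\<^sub>\<infinity>n\<in>UNIV - A. (x n)\<^sup>2)"
    by (intro infsum_cong_neutral) auto
  also have "\<dots> = (\<Sum>\<^sub>\<infinity>n. (x n)\<^sup>2) - (\<Sum>n\<in>A. (x n)\<^sup>2)"
    using s A(1) by (subst infsum_Diff) auto
  also have "\<dots> \<le> 1" using A(2) by (simp add: dist_real_def)
  finally have "ell2_dist x ?y \<le> 1" by (simp add: ell2_dist_def)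
  with A(1) y show ?thesis by (rule that)
qed

text \<open>Truncation to finitely many coordinates moves each image point by at most \<open>1\<close>, which is invisible on
the large scale, and on finitely supported sequences \<open>c \<mapsto> (\<Sum>n. c n * rademacher n)\<close> is bi-Lipschitz by
Khinchin's inequality. In this way only finite Rademacher sums occur.\<close>

lemma coarsely_embeddable_Lp01_if_ell2:
  assumes X: "Metric_space X d" and p: "1 \<le> p" "p \<le> 2"
    and emb: "coarsely_embeddable X d ell2 ell2_dist"
  shows "coarsely_embeddable X d (Lp01 p) (Lp01_dist p)"
proof -
  interpret ell2: Metric_space ell2 ell2_dist by (rule Metric_space_ell2)
  obtain f where f: "coarse_embedding X d ell2 ell2_dist f"
    using emb by (auto simp: coarsely_embeddable_def)
  have f_ell2: "f x \<in> ell2" if "x \<in> X" for x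
    using f that by (auto simp: coarse_embedding_def)
  have "\<forall>x\<in>X. \<exists>A. finite A \<and> (\<lambda>n. if n \<in> A then f x n else 0) \<in> ell2 \<and>
      ell2_dist (f x) (\<lambda>n. if n \<in> A then f x n else 0) \<le> 1"
    using ell2_finite_support_approx[OF f_ell2] by blast
  from bchoice[OF this] obtain A where A: "\<forall>x\<in>X. finite (A x) \<and>
      (\<lambda>n. if n \<in> A x then f x n else 0) \<in> ell2 \<and>
      ell2_dist (f x) (\<lambda>n. if n \<in> A x then f x n else 0) \<le> 1"
    by (rule exE)
  define c where "c x n = (if n \<in> A x then f x n else 0)" for x n
  have c: "c x \<in> ell2" "ell2_dist (f x) (c x) \<le> 1" if "x \<in> X" for x
    using bspec[OF A that] unfolding c_def[abs_def] by auto
  let ?S = "\<lambda>x. rademacher_sum (A x) (c x)"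
  define g where "g x = Lp_rel unit_interval p `` {?S x}" for x
  have S_Lp: "?S x \<in> Lp_functions unit_interval p" for x
    using p by (intro rademacher_sum_Lp) simp
  have norm: "ell2_dist (c x) (c y) / 8 \<le> Lp01_dist p (g x) (g y)"
    "Lp01_dist p (g x) (g y) \<le> 2 * ell2_dist (c x) (c y)" if xy: "x \<in> X" "y \<in> X" for x y
  proof -
    let ?B = "A x \<union> A y"
    have B: "finite ?B" using A xy by simp
    have "?S z = rademacher_sum ?B (c z)" if "z \<in> {x, y}" for z
      unfolding rademacher_sum_def fun_eq_iff
      using B that by (intro allI sum.mono_neutral_left) (auto simp: c_def)
    then have diff: "?S x t - ?S y t = rademacher_sum ?B (\<lambda>n. c x n - c y n) t" for t
      by (simp add: rademacher_sum_def left_diff_distrib sum_subtractf)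
    have "(\<Sum>\<^sub>\<infinity>n. (c x n - c y n)\<^sup>2) = (\<Sum>\<^sub>\<infinity>n\<in>?B. (c x n - c y n)\<^sup>2)"
      by (intro infsum_cong_neutral) (auto simp: c_def)
    then have "ell2_dist (c x) (c y) = sqrt (\<Sum>n\<in>?B. (c x n - c y n)\<^sup>2)"
      using B by (simp add: ell2_dist_def)
    moreover have "Lp01_dist p (g x) (g y)
        = Lp_norm unit_interval p (rademacher_sum ?B (\<lambda>n. c x n - c y n))"
      unfolding g_def Lp_dist_class[OF S_Lp S_Lp] by (simp add: diff)
    ultimately show "ell2_dist (c x) (c y) / 8 \<le> Lp01_dist p (g x) (g y)"
      "Lp01_dist p (g x) (g y) \<le> 2 * ell2_dist (c x) (c y)"
      using khinchin[OF p B, of "\<lambda>n. c x n - c y n"] by simp_all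
  qed
  have close: "ell2_dist (f x) (f y) - 2 \<le> ell2_dist (c x) (c y)"
    "ell2_dist (c x) (c y) \<le> ell2_dist (f x) (f y) + 2" if xy: "x \<in> X" "y \<in> X" for x y
  proof -
    note mem = f_ell2[OF xy(1)] f_ell2[OF xy(2)] c(1)[OF xy(1)] c(1)[OF xy(2)]
    note le = c(2)[OF xy(1)] c(2)[OF xy(2)]
    show "ell2_dist (f x) (f y) - 2 \<le> ell2_dist (c x) (c y)"
      using ell2.triangle[OF mem(1,3,2)] ell2.triangle[OF mem(3,4,2)] le ell2.commute[of "c y" "f y"]
      by linarith
    show "ell2_dist (c x) (c y) \<le> ell2_dist (f x) (f y) + 2"
      using ell2.triangle[OF mem(3,1,4)] ell2.triangle[OF mem(1,2,4)] le ell2.commute[of "c x" "f x"]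
      by linarith
  qed
  have "coarse_embedding X d (Lp01 p) (Lp01_dist p) g"
  proof (rule coarse_embedding_control_target[OF X f])
    show "g \<in> X \<rightarrow> Lp01 p"
      unfolding g_def Lp_space_def by (intro Pi_I quotientI S_Lp)
    show "filterlim (\<lambda>t. 1 / 8 * max 0 (t - 2) :: real) at_top at_top"
      by (rule filterlim_tendsto_pos_mult_at_top[OF tendsto_const _ filterlim_truncated_shift]) simp
    show "(\<lambda>t. 1 / 8 * max 0 (t - 2) :: real) \<in> {0..} \<rightarrow> {0..}" "(\<lambda>t. 2 * (t + 2) :: real) \<in> {0..} \<rightarrow> {0..}"
      "mono_on {0..} (\<lambda>t. 1 / 8 * max 0 (t - 2) :: real)" "mono_on {0..} (\<lambda>t. 2 * (t + 2) :: real)"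
      by (auto simp: monotone_on_def)
    fix x y assume xy: "x \<in> X" "y \<in> X"
    show "1 / 8 * max 0 (ell2_dist (f x) (f y) - 2) \<le> Lp01_dist p (g x) (g y)"
      using norm(1)[OF xy] close(1)[OF xy] Lp_norm_nonneg[of unit_interval p]
      by (simp add: max_def Lp_dist_def)
    show "Lp01_dist p (g x) (g y) \<le> 2 * (ell2_dist (f x) (f y) + 2)"
      using norm(2)[OF xy] close(2)[OF xy] by simp
  qed
  then show ?thesis by (auto simp: coarsely_embeddable_def)
qed

theorem corollary4p5:
  fixes X :: "'a set" and d :: "'a \<Rightarrow> 'a \<Rightarrow> real"
  assumes "Metric_space X d"
    and "separable_space (Metric_space.mtopology X d)"
  shows "(coarsely_embeddable X d ell2 ell2_dist \<longleftrightarrow>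
           (\<exists>p. 1 \<le> p \<and> p < 2 \<and> coarsely_embeddable X d (Lp01 p) (Lp01_dist p)))
       \<and> (coarsely_embeddable X d ell2 ell2_dist \<longleftrightarrow>
           (\<forall>p. 1 \<le> p \<and> p < 2 \<longrightarrow> coarsely_embeddable X d (Lp01 p) (Lp01_dist p)))"
proof -
  let ?H = "coarsely_embeddable X d ell2 ell2_dist"
    and ?L = "\<lambda>p. coarsely_embeddable X d (Lp01 p) (Lp01_dist p)"
  have "?H" if "1 \<le> p" "p < 2" "?L p" for p
    using coarsely_embeddable_ell2_if_Lp[OF assms that] .
  moreover have "?L p" if "?H" "1 \<le> p" "p < 2" for p
    using coarsely_embeddable_Lp01_if_ell2[OF assms(1)] that by simp
  moreover have "1 \<le> (1::real) \<and> (1::real) < 2" by simp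
  ultimately show ?thesis by blast
qed

end
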